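(* Let $\{\Pi_j\}$ be a minimal informationally complete (IC) measurement on a $d$-dimensional quantum system, serving as a basis for the Lie algebra $\mathfrak{u}(d)$. Then the structure constants $C_{jkl}$ of this basis, defined by $[\Pi_j,\Pi_k]=\sum_l C_{jkl}\Pi_l$, are completely antisymmetric if and only if $\{\Pi_j\}$ is a generalized SIC measurement.
   Context: A measurement is a finite set of positive semidefinite operators $\Pi_j$ on $\mathbb{C}^d$ with $\sum_j\Pi_j=1$ (the identity operator). It is informationally complete (IC) if the $\Pi_j$ span the whole operator space, and minimal IC if in addition it has exactly $d^2$ outcomes; the outcomes are then a basis of Hermitian operators. The Lie algebra $\mathfrak{u}(d)$ is taken with a basis of Hermitian operators (physics convention), so the structure constants are purely imaginary. Completely antisymmetric means that $C_{jkl}$ changes sign under the interchange of any two of its three indices. A measurement $\{\Pi_j=P_j/d\}$ is a generalized SIC measurement if it is IC and $\tr(P_jP_k)=\alpha\delta_{jk}+\zeta$ for all $j,k$, for some real constants $\alpha,\zeta$. *)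

theory Defs
  imports "HOL-Analysis.Analysis"
begin

text \<open>
  Operators on \<open>\<complex>\<^sup>d\<close> are matrices of type \<open>complex ^ 'n ^ 'n\<close> with \<open>d = CARD('n)\<close>.
  The scalar multiplication \<open>*\<^sub>R\<close> of this type is only real, so the complex one is
  introduced here; \<open>cmat.span\<close> below is the complex linear span.
\<close>

definition cmat_scale :: "complex \<Rightarrow> complex ^ 'n ^ 'n \<Rightarrow> complex ^ 'n ^ 'n" where
  "cmat_scale c A = (\<chi> i j. c * A $ i $ j)"

definition matrix_unit :: "'n \<times> 'n \<Rightarrow> complex ^ 'n ^ 'n" where
  "matrix_unit p = (\<chi> i j. if p = (i, j) then 1 else 0)"

lemma cmat_scale_nth [simp]: "cmat_scale c A $ i $ j = c * A $ i $ j"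
  by (simp add: cmat_scale_def)

interpretation cmat: vector_space "cmat_scale :: complex \<Rightarrow> complex ^ 'n ^ 'n \<Rightarrow> _"
  by unfold_locales (simp_all add: vec_eq_iff algebra_simps)

lemma inj_matrix_unit: "inj (matrix_unit :: 'n \<times> 'n \<Rightarrow> complex ^ 'n ^ 'n)"
proof (rule injI)
  fix p q :: "'n \<times> 'n"
  assume "matrix_unit p = matrix_unit q"
  then have "matrix_unit p $ fst p $ snd p = matrix_unit q $ fst p $ snd p"
    by simp
  then show "p = q"
    by (simp add: matrix_unit_def split: if_splits)
qed

lemma sum_matrix_unit_nth:
  "(\<Sum>p\<in>UNIV. cmat_scale (u p) (matrix_unit p)) $ i $ j = u (i, j)"
  by (simp add: matrix_unit_def if_distrib [of "\<lambda>x. _ * x"] cong: if_cong)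

interpretation cmat: finite_dimensional_vector_space
  "cmat_scale :: complex \<Rightarrow> complex ^ 'n ^ 'n \<Rightarrow> _" "range matrix_unit"
proof
  show "finite (range (matrix_unit :: 'n \<times> 'n \<Rightarrow> _))"
    by simp
  show "cmat.independent (range (matrix_unit :: 'n \<times> 'n \<Rightarrow> _))"
  proof (rule cmat.independent_if_scalars_zero)
    fix f :: "complex ^ 'n ^ 'n \<Rightarrow> complex" and x :: "complex ^ 'n ^ 'n"
    assume f: "(\<Sum>x\<in>range matrix_unit. cmat_scale (f x) x) = 0" and "x \<in> range matrix_unit"
    then obtain p where p: "x = matrix_unit p"
      by blast
    have "(\<Sum>p\<in>UNIV. cmat_scale (f (matrix_unit p)) (matrix_unit p)) = (0 :: complex ^ 'n ^ 'n)"
      using f by (simp add: sum.reindex [OF inj_matrix_unit])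
    then show "f x = 0"
      using sum_matrix_unit_nth [of "\<lambda>p. f (matrix_unit p)" "fst p" "snd p"] p by simp
  qed simp
  show "cmat.span (range (matrix_unit :: 'n \<times> 'n \<Rightarrow> _)) = UNIV"
  proof (intro equalityI subsetI UNIV_I)
    fix A :: "complex ^ 'n ^ 'n"
    have "A = (\<Sum>p\<in>UNIV. cmat_scale (A $ fst p $ snd p) (matrix_unit p))"
      by (simp add: vec_eq_iff sum_matrix_unit_nth del: sum_component)
    also have "\<dots> \<in> cmat.span (range matrix_unit)"
      by (intro cmat.span_sum cmat.span_scale cmat.span_base) simp
    finally show "A \<in> cmat.span (range matrix_unit)" .
  qed
qed

definition hermitian :: "complex ^ 'n ^ 'n \<Rightarrow> bool" where
  "hermitian A \<longleftrightarrow> (\<forall>i j. A $ j $ i = cnj (A $ i $ j))"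

definition positive_semidefinite :: "complex ^ 'n ^ 'n \<Rightarrow> bool" where
  "positive_semidefinite A \<longleftrightarrow>
     hermitian A \<and> (\<forall>v. (\<Sum>i\<in>UNIV. cnj (v $ i) * (A *v v) $ i) \<in> nonneg_Reals)"

definition measurement :: "('j::finite \<Rightarrow> complex ^ 'n ^ 'n) \<Rightarrow> bool" where
  "measurement E \<longleftrightarrow> (\<forall>j. positive_semidefinite (E j)) \<and> (\<Sum>j\<in>UNIV. E j) = mat 1"

definition informationally_complete :: "('j::finite \<Rightarrow> complex ^ 'n ^ 'n) \<Rightarrow> bool" where
  "informationally_complete E \<longleftrightarrow> measurement E \<and> cmat.span (range E) = UNIV"

definition minimal_IC :: "('j::finite \<Rightarrow> complex ^ 'n ^ 'n) \<Rightarrow> bool" where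
  "minimal_IC E \<longleftrightarrow> informationally_complete E \<and> CARD('j) = CARD('n)\<^sup>2"

definition generalized_SIC :: "('j::finite \<Rightarrow> complex ^ 'n ^ 'n) \<Rightarrow> bool" where
  "generalized_SIC E \<longleftrightarrow> informationally_complete E \<and>
     (let P = (\<lambda>j. cmat_scale (of_nat CARD('n)) (E j)) in
       \<exists>\<alpha> \<zeta> :: real. \<forall>j k. trace (P j ** P k) = of_real (\<alpha> * (if j = k then 1 else 0) + \<zeta>))"

definition commutator :: "complex ^ 'n ^ 'n \<Rightarrow> complex ^ 'n ^ 'n \<Rightarrow> complex ^ 'n ^ 'n" where
  "commutator A B = A ** B - B ** A"

text \<open>
  The description is proper whenever \<open>E\<close> is a basis, in particular for a minimal IC
  measurement: see \<open>ex1_structure_constants\<close>.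
\<close>

definition structure_constants ::
    "('j::finite \<Rightarrow> complex ^ 'n ^ 'n) \<Rightarrow> 'j \<Rightarrow> 'j \<Rightarrow> 'j \<Rightarrow> complex" where
  "structure_constants E =
     (THE C. \<forall>j k. commutator (E j) (E k) = (\<Sum>l\<in>UNIV. cmat_scale (C j k l) (E l)))"

definition completely_antisymmetric :: "('j \<Rightarrow> 'j \<Rightarrow> 'j \<Rightarrow> complex) \<Rightarrow> bool" where
  "completely_antisymmetric C \<longleftrightarrow>
     (\<forall>j k l. C k j l = - C j k l \<and> C l k j = - C j k l \<and> C j l k = - C j k l)"

lemma minimal_IC_basis:
  fixes E :: "'j::finite \<Rightarrow> complex ^ 'n ^ 'n"
  assumes "minimal_IC E"
  shows "inj E" and "cmat.independent (range E)" and "cmat.span (range E) = UNIV"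
proof -
  show span: "cmat.span (range E) = UNIV"
    using assms by (simp add: minimal_IC_def informationally_complete_def)
  have "card (range (matrix_unit :: 'n \<times> 'n \<Rightarrow> _)) = CARD('n)\<^sup>2"
    by (simp add: card_image [OF inj_matrix_unit] power2_eq_square)
  then have dim: "cmat.dim (UNIV :: (complex ^ 'n ^ 'n) set) = CARD('j)"
    using assms by (simp add: minimal_IC_def)
  have le: "card (range E) \<le> CARD('j)"
    by (simp add: card_image_le)
  show "cmat.independent (range E)"
    by (rule cmat.card_le_dim_spanning [of _ UNIV]) (use span dim le in auto)
  then have "card (range E) = CARD('j)"
    using cmat.dim_span_eq_card_independent [of "range E"] span dim by simp
  then show "inj E"
    by (simp add: eq_card_imp_inj_on)
qed

lemma ex1_structure_constants:
  fixes E :: "'j::finite \<Rightarrow> complex ^ 'n ^ 'n"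
  assumes "minimal_IC E"
  shows "\<exists>!C. \<forall>j k. commutator (E j) (E k) = (\<Sum>l\<in>UNIV. cmat_scale (C j k l) (E l))"
proof -
  note basis = minimal_IC_basis [OF assms]
  have ex: "\<exists>c. A = (\<Sum>l\<in>UNIV. cmat_scale (c l) (E l))" for A
  proof -
    have "A \<in> range (\<lambda>u. \<Sum>v\<in>range E. cmat_scale (u v) v)"
      using basis(3) cmat.span_finite [of "range E"] by simp
    then obtain u where "A = (\<Sum>v\<in>range E. cmat_scale (u v) v)"
      by blast
    then have "A = (\<Sum>l\<in>UNIV. cmat_scale (u (E l)) (E l))"
      by (simp add: sum.reindex [OF basis(1)])
    then show ?thesis
      by (rule exI [of _ "\<lambda>l. u (E l)"])
  qed
  have uniq: "c = c'"
    if "(\<Sum>l\<in>UNIV. cmat_scale (c l) (E l)) = (\<Sum>l\<in>UNIV. cmat_scale (c' l) (E l))" for c c'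
  proof
    fix l
    let ?u = "\<lambda>v. c (inv E v) - c' (inv E v)"
    have "(\<Sum>v\<in>range E. cmat_scale (?u v) v) = 0"
      using that
      by (simp add: sum.reindex [OF basis(1)] inv_f_f [OF basis(1)]
        cmat.scale_left_diff_distrib sum_subtractf)
    then have "?u (E l) = 0"
      using cmat.independentD [OF basis(2), of "range E" ?u "E l"] by simp
    then show "c l = c' l"
      by (simp add: inv_f_f [OF basis(1)])
  qed
  have "\<forall>A. \<exists>c. A = (\<Sum>l\<in>UNIV. cmat_scale (c l) (E l))"
    using ex by blast
  from choice [OF this] obtain c where c: "\<And>A. A = (\<Sum>l\<in>UNIV. cmat_scale (c A l) (E l))"
    by blast
  show ?thesis
  proof (rule ex1I)
    show "\<forall>j k. commutator (E j) (E k) =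
        (\<Sum>l\<in>UNIV. cmat_scale (c (commutator (E j) (E k)) l) (E l))"
      by (intro allI) (rule c)
  next
    fix C
    assume C: "\<forall>j k. commutator (E j) (E k) = (\<Sum>l\<in>UNIV. cmat_scale (C j k l) (E l))"
    show "C = (\<lambda>j k. c (commutator (E j) (E k)))"
    proof (intro ext)
      fix j k l
      have "C j k = c (commutator (E j) (E k))"
        by (rule uniq, rule trans [OF _ c])
          (rule sym, rule C [rule_format])
      then show "C j k l = c (commutator (E j) (E k)) l"
        by simp
    qed
  qed
qed

lemma commutator_eq_structure_constants:
  assumes "minimal_IC E"
  shows "commutator (E j) (E k) = (\<Sum>l\<in>UNIV. cmat_scale (structure_constants E j k l) (E l))"
  using theI' [OF ex1_structure_constants [OF assms]]
  unfolding structure_constants_def by blast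

end

theory Submission
  imports Defs
begin

text \<open>
  The frame operator \<open>\<Phi> X = (\<Sum>l. tr (X E\<^sub>l) E\<^sub>l)\<close> has the Gram matrix of \<open>E\<close> as its matrix in the
  basis \<open>E\<close>. If the structure constants are completely antisymmetric, then \<open>\<Phi>\<close> commutes with the
  adjoint action, so by Schur's lemma it has the form \<open>\<Phi> X = a X + b tr X\<close>; comparing coefficients
  (with \<open>(\<Sum>l. E\<^sub>l) = 1\<close>), the Gram matrix is \<open>a \<delta>\<^sub>j\<^sub>k + b tr E\<^sub>j\<close>, and it is symmetric.
  Conversely, if the Gram matrix is \<open>a \<delta>\<^sub>j\<^sub>k + z\<close>, then all \<open>tr E\<^sub>l\<close> agree, hence
  \<open>(\<Sum>l. C\<^sub>j\<^sub>k\<^sub>l) = 0\<close> and \<open>a C\<^sub>j\<^sub>k\<^sub>l = tr ([E\<^sub>j, E\<^sub>k] E\<^sub>l)\<close>, which is completely antisymmetric.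
  If \<open>a = 0\<close>, then all \<open>E\<^sub>j\<close> coincide by nondegeneracy of the trace form, and \<open>C = 0\<close>.
\<close>

section \<open>Traces and commutators of complex matrices\<close>

lemma cmat_scale_mult_left: "cmat_scale c A ** B = cmat_scale c (A ** B)"
  by (simp add: vec_eq_iff matrix_matrix_mult_def sum_distrib_left mult.assoc)

lemma cmat_scale_mult_right: "A ** cmat_scale c B = cmat_scale c (A ** B)"
  by (simp add: vec_eq_iff matrix_matrix_mult_def sum_distrib_left mult.left_commute)

lemma trace_cmat_scale: "trace (cmat_scale c A) = c * trace A"
  by (simp add: trace_def sum_distrib_left)

lemma trace_sum: "trace (\<Sum>l\<in>S. F l) = (\<Sum>l\<in>S. trace (F l))"
  by (induction S rule: infinite_finite_induct) (simp_all add: trace_def sum.distrib)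

lemma matrix_add_rdistrib: "(A + B) ** C = A ** C + B ** C"
  for A B :: "complex ^ 'n ^ 'n"
  by (simp add: vec_eq_iff matrix_matrix_mult_def distrib_right sum.distrib)

lemma matrix_diff_rdistrib: "(A - B) ** C = A ** C - B ** C"
  for A B :: "complex ^ 'n ^ 'n"
  by (simp add: vec_eq_iff matrix_matrix_mult_def left_diff_distrib sum_subtractf)

lemma sum_matrix_mult:
  fixes F :: "'a \<Rightarrow> complex ^ 'n ^ 'n"
  shows "(\<Sum>l\<in>S. F l) ** B = (\<Sum>l\<in>S. F l ** B)"
  by (induction S rule: infinite_finite_induct) (simp_all add: matrix_add_rdistrib)

text \<open>Pairing with matrix units reads off single entries, which yields nondegeneracy of the
  trace form.\<close>

lemma trace_mult_matrix_unit: "trace (X ** matrix_unit (k, l)) = X $ l $ k"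
proof -
  have "trace (X ** matrix_unit (k, l)) = (\<Sum>i\<in>UNIV. if i = l then X $ i $ k else 0)"
    unfolding trace_def
  proof (rule sum.cong)
    fix i
    have "(X ** matrix_unit (k, l)) $ i $ i =
        (\<Sum>r\<in>UNIV. if r = k then (if i = l then X $ i $ r else 0) else 0)"
      unfolding matrix_matrix_mult_def matrix_unit_def vec_lambda_beta by (rule sum.cong) auto
    then show "(X ** matrix_unit (k, l)) $ i $ i = (if i = l then X $ i $ k else 0)"
      by simp
  qed simp
  then show ?thesis
    by simp
qed

lemma commutator_add_right: "commutator A (X + Y) = commutator A X + commutator A Y"
  by (simp add: commutator_def matrix_add_ldistrib matrix_add_rdistrib)

lemma commutator_scale_right: "commutator A (cmat_scale c X) = cmat_scale c (commutator A X)"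
  by (simp add: commutator_def cmat_scale_mult_left cmat_scale_mult_right
      cmat.scale_right_diff_distrib)

lemma commutator_zero_right: "commutator A 0 = 0"
  by (simp add: commutator_def)

lemma commutator_sum_right: "commutator A (\<Sum>l\<in>S. F l) = (\<Sum>l\<in>S. commutator A (F l))"
  by (induction S rule: infinite_finite_induct)
     (simp_all add: commutator_add_right commutator_zero_right)

lemma commutator_add_left: "commutator (X + Y) A = commutator X A + commutator Y A"
  by (simp add: commutator_def matrix_add_ldistrib matrix_add_rdistrib)

lemma commutator_scale_left: "commutator (cmat_scale c X) A = cmat_scale c (commutator X A)"
  by (simp add: commutator_def cmat_scale_mult_left cmat_scale_mult_right
      cmat.scale_right_diff_distrib)

lemma commutator_zero_left: "commutator 0 A = 0"
  by (simp add: commutator_def)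

lemma trace_commutator: "trace (commutator A B) = 0"
  by (simp add: commutator_def trace_sub trace_mul_sym [of A B])

lemma trace_commutator_mult_rotate:
  "trace (commutator A B ** C) = trace (commutator B C ** A)"
proof -
  have "trace (A ** B ** C) = trace (B ** C ** A)" "trace (B ** A ** C) = trace (C ** B ** A)"
    by (metis trace_mul_sym matrix_mul_assoc)+
  then show ?thesis
    by (simp add: commutator_def matrix_diff_rdistrib trace_sub)
qed

text \<open>Invariance of the trace form: the adjoint action of \<open>A\<close> is skew. Two cyclic
  rotations followed by reversing the commutator give the sign.\<close>

lemma trace_commutator_mult_swap:
  "trace (commutator A B ** C) = - trace (commutator A C ** B)"
proof -
  have "trace (commutator A B ** C) = trace (commutator C A ** B)"
    by (metis trace_commutator_mult_rotate)
  then show ?thesis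
    by (simp add: commutator_def matrix_diff_rdistrib trace_sub)
qed

lemma commutator_matrix_unit_nth:
  "commutator (matrix_unit (k, l)) M $ p $ q =
     (if p = k then M $ l $ q else 0) - (if q = l then M $ p $ k else 0)"
proof -
  have "(matrix_unit (k, l) ** M) $ p $ q =
      (\<Sum>r\<in>UNIV. if r = l then (if p = k then M $ r $ q else 0) else 0)"
    unfolding matrix_matrix_mult_def matrix_unit_def vec_lambda_beta by (rule sum.cong) auto
  moreover have "(M ** matrix_unit (k, l)) $ p $ q =
      (\<Sum>r\<in>UNIV. if r = k then (if q = l then M $ p $ r else 0) else 0)"
    unfolding matrix_matrix_mult_def matrix_unit_def vec_lambda_beta by (rule sum.cong) auto
  ultimately show ?thesis
    by (simp add: commutator_def)
qed

text \<open>Schur's lemma for the adjoint representation, which splits into scalars and traceless matrices.\<close>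

lemma commutator_equivariant_form:
  fixes \<Phi> :: "complex ^ 'n ^ 'n \<Rightarrow> complex ^ 'n ^ 'n"
  assumes add: "\<And>X Y. \<Phi> (X + Y) = \<Phi> X + \<Phi> Y"
    and scale: "\<And>c X. \<Phi> (cmat_scale c X) = cmat_scale c (\<Phi> X)"
    and comm: "\<And>A X. \<Phi> (commutator A X) = commutator A (\<Phi> X)"
  obtains a b where "\<And>X. \<Phi> X = cmat_scale a X + cmat_scale (b * trace X) (mat 1)"
proof -
  let ?e = "\<lambda>i j. matrix_unit (i, j) :: complex ^ 'n ^ 'n"
  have zero: "\<Phi> 0 = 0"
    using scale [of 0 0] by simp
  have sum: "\<Phi> (\<Sum>l\<in>S. F l) = (\<Sum>l\<in>S. \<Phi> (F l))" for S :: "('n \<times> 'n) set" and F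
    by (induction S rule: infinite_finite_induct) (simp_all add: zero add)
  have diff: "\<Phi> (X - Y) = \<Phi> X - \<Phi> Y" for X Y
    using add [of "X - Y" Y] by (simp add: algebra_simps)
  have "\<exists>a b. \<Phi> (?e i i) = cmat_scale a (?e i i) + cmat_scale b (mat 1)" for i
  proof -
    define M where "M = \<Phi> (?e i i)"
    \<comment> \<open>The condition selects exactly the matrix units that commute with
      \<open>?e i i\<close>. By equivariance they also commute with \<open>M\<close>; the equation
      is this fact read entrywise.\<close>
    have entry: "(if p = k then M $ l $ q else 0) = (if q = l then M $ p $ k else 0)"
      if "k = i \<longleftrightarrow> l = i" for k l p q
    proof -
      have "commutator (?e k l) (?e i i) = 0"
        unfolding vec_eq_iff commutator_matrix_unit_nth using that by (auto simp: matrix_unit_def)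
      then have "commutator (?e k l) M = 0"
        using comm [of "?e k l" "?e i i"] by (simp add: M_def zero)
      then show ?thesis
        using commutator_matrix_unit_nth [of k l M p q] by simp
    qed
    obtain b where b: "\<And>k. k \<noteq> i \<Longrightarrow> M $ k $ k = b"
    proof (cases "\<exists>k. k \<noteq> i")
      case True
      then obtain k where "k \<noteq> i" by blast
      then have "M $ l $ l = M $ k $ k" if "l \<noteq> i" for l
        using entry [of k l k l] that by simp
      then show ?thesis by (rule that)
    next
      \<comment> \<open>In dimension one there is no index besides \<open>i\<close>, so any
        \<open>b\<close> meets the requirement vacuously.\<close>
      case False
      then show ?thesis using that by blast
    qed
    have "M $ p $ q = 0" if "p \<noteq> q" for p q
      using entry [of p p p q] that by simp
    then have "M = cmat_scale (M $ i $ i - b) (?e i i) + cmat_scale b (mat 1)"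
      unfolding vec_eq_iff by (auto simp: b mat_def matrix_unit_def)
    then show ?thesis
      unfolding M_def by blast
  qed
  then obtain a b where diag:
    "\<And>i. \<Phi> (?e i i) = cmat_scale (a i) (?e i i) + cmat_scale (b i) (mat 1)"
    by metis
  have ad_one: "commutator A (mat 1) = 0" for A :: "complex ^ 'n ^ 'n"
    by (simp add: commutator_def)
  \<comment> \<open>Up to sign, \<open>?e i j\<close> is the commutator of itself with
    \<open>?e j j\<close> and also with \<open>?e i i\<close>, and the identity part of the image
    drops out. The two computations yield the factors \<open>a j\<close> and \<open>a i\<close>,
    which must agree.\<close>
  have off1: "\<Phi> (?e i j) = cmat_scale (a j) (?e i j)" if "i \<noteq> j" for i j
  proof -
    have "commutator (?e i j) (?e j j) = ?e i j"
      unfolding vec_eq_iff commutator_matrix_unit_nth using that by (auto simp: matrix_unit_def)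
    then show ?thesis
      using comm [of "?e i j" "?e j j"]
      by (simp add: diag commutator_add_right commutator_scale_right ad_one)
  qed
  have off2: "\<Phi> (?e i j) = cmat_scale (a i) (?e i j)" if "i \<noteq> j" for i j
  proof -
    have "commutator (?e i j) (?e i i) = cmat_scale (- 1) (?e i j)"
      unfolding vec_eq_iff commutator_matrix_unit_nth using that by (auto simp: matrix_unit_def)
    then show ?thesis
      using comm [of "?e i j" "?e i i"] diff [of 0 "?e i j"]
      by (simp add: diag zero commutator_add_right commutator_scale_right ad_one)
  qed
  have a_eq: "a i = a j" for i j
  proof (cases "i = j")
    case False
    then have "cmat_scale (a i) (?e i j) $ i $ j = cmat_scale (a j) (?e i j) $ i $ j"
      using off1 off2 by metis
    then show ?thesis by (simp add: matrix_unit_def)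
  qed simp
  have b_eq: "b i = b j" for i j
  proof (cases "i = j")
    case False
    \<comment> \<open>The difference of two diagonal units is a commutator of off-diagonal ones, so
      its image has no identity part; this forces \<open>b i - b j\<close> to vanish.\<close>
    have c: "commutator (?e i j) (?e j i) = ?e i i - ?e j j"
      unfolding vec_eq_iff commutator_matrix_unit_nth by (auto simp: matrix_unit_def)
    have "\<Phi> (?e i i - ?e j j) = cmat_scale (a i) (?e i i - ?e j j)"
      using comm [of "?e i j" "?e j i"] off1 [of j i] False
      by (simp add: c commutator_scale_right)
    then have "(cmat_scale (a i) (?e i i) + cmat_scale (b i) (mat 1) -
        (cmat_scale (a j) (?e j j) + cmat_scale (b j) (mat 1))) $ i $ i =
        cmat_scale (a i) (?e i i - ?e j j) $ i $ i"
      unfolding diff diag by simp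
    then show ?thesis
      using False by (simp add: matrix_unit_def mat_def)
  qed simp
  obtain a0 b0 where ab: "\<And>i. a i = a0" "\<And>i. b i = b0"
    using a_eq b_eq by metis
  have unit: "\<Phi> (matrix_unit p) = cmat_scale a0 (matrix_unit p) +
      cmat_scale (if fst p = snd p then b0 else 0) (mat 1)" for p
    using diag off1 by (cases p) (simp add: ab)
  show ?thesis
  proof (rule that [of "a0" "b0"])
    fix X :: "complex ^ 'n ^ 'n"
    let ?u = "\<lambda>p. X $ fst p $ snd p"
    have X: "X = (\<Sum>p\<in>UNIV. cmat_scale (?u p) (matrix_unit p))"
      by (simp add: vec_eq_iff sum_matrix_unit_nth del: sum_component)
    have tr: "trace X = (\<Sum>p\<in>UNIV. if fst p = snd p then ?u p else 0)"
      using sum.cartesian_product' [of "\<lambda>p. if fst p = snd p then ?u p else 0" UNIV UNIV]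
      by (simp add: trace_def)
    have "\<Phi> X = (\<Sum>p\<in>UNIV. cmat_scale (?u p) (\<Phi> (matrix_unit p)))"
      by (subst X) (simp add: sum scale)
    also have "\<dots> = cmat_scale a0 (\<Sum>p\<in>UNIV. cmat_scale (?u p) (matrix_unit p)) +
        (\<Sum>p\<in>UNIV. cmat_scale (b0 * (if fst p = snd p then ?u p else 0)) (mat 1))"
      unfolding unit cmat.scale_sum_right sum.distrib [symmetric]
      by (intro sum.cong) (simp_all add: cmat.scale_right_distrib mult.commute)
    also have "\<dots> = cmat_scale a0 X + cmat_scale (b0 * trace X) (mat 1)"
      by (simp add: tr sum_distrib_left flip: cmat.scale_sum_left X)
    finally show "\<Phi> X = cmat_scale a0 X + cmat_scale (b0 * trace X) (mat 1)" .
  qed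
qed

section \<open>Nondegeneracy and comparison of coefficients\<close>

text \<open>Orthogonality to a spanning set extends by linearity to all matrices, in particular to
  the matrix units, which detect every entry of \<open>X\<close>.\<close>

lemma trace_form_nondegenerate:
  assumes "cmat.span S = UNIV" "\<And>A. A \<in> S \<Longrightarrow> trace (X ** A) = 0"
  shows "X = 0"
proof -
  have "trace (X ** A) = 0" for A
  proof (rule cmat.span_induct [of A S])
    show "cmat.subspace {A. trace (X ** A) = 0}"
      by (rule cmat.subspaceI)
         (auto simp: matrix_add_ldistrib trace_def [of 0] trace_add cmat_scale_mult_right trace_cmat_scale)
  qed (use assms in auto)
  from this [of "matrix_unit (_, _)"] show ?thesis
    by (simp add: vec_eq_iff trace_mult_matrix_unit)
qed

lemma minimal_IC_coeff_unique:
  assumes "minimal_IC E"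
    and "(\<Sum>l\<in>UNIV. cmat_scale (c l) (E l)) = (\<Sum>l\<in>UNIV. cmat_scale (c' l) (E l))"
  shows "c l = c' l"
proof -
  note basis = minimal_IC_basis [OF assms(1)]
  \<comment> \<open>Independence concerns the set \<open>range E\<close>; \<open>inv E\<close>
    carries the coefficients from outcomes to elements of that set.\<close>
  let ?u = "\<lambda>v. c (inv E v) - c' (inv E v)"
  have "(\<Sum>v\<in>range E. cmat_scale (?u v) v) = 0"
    using assms(2)
    by (simp add: sum.reindex [OF basis(1)] inv_f_f [OF basis(1)]
      cmat.scale_left_diff_distrib sum_subtractf)
  then have "?u (E l) = 0"
    using cmat.independentD [OF basis(2), of "range E" ?u "E l"] by simp
  then show ?thesis
    by (simp add: inv_f_f [OF basis(1)])
qed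

section \<open>Gram matrices of generalized SIC measurements\<close>

lemma trace_mult_hermitian_real:
  assumes "hermitian A" "hermitian B"
  shows "trace (A ** B) \<in> \<real>"
proof -
  have "cnj (A $ i $ k) = A $ k $ i" "cnj (B $ i $ k) = B $ k $ i" for i k
    using assms unfolding hermitian_def by metis+
  then have "cnj (trace (A ** B)) = (\<Sum>i\<in>UNIV. \<Sum>k\<in>UNIV. A $ k $ i * B $ i $ k)"
    by (simp add: trace_def matrix_matrix_mult_def)
  also have "\<dots> = trace (A ** B)"
    by (subst sum.swap) (simp add: trace_def matrix_matrix_mult_def)
  finally show ?thesis
    by (simp add: Reals_cnj_iff)
qed

text \<open>Passing from \<open>E\<close> to the rescaled operators multiplies the Gram matrix by
  the square of the dimension. Complex constants suffice because the Gram entries are real, so real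
  parts may be taken.\<close>

lemma gram_iff_generalized_SIC:
  fixes E :: "'j::finite \<Rightarrow> complex ^ 'n ^ 'n"
  assumes "informationally_complete E"
  shows "generalized_SIC E \<longleftrightarrow>
    (\<exists>a z. \<forall>j k. trace (E j ** E k) = a * (if j = k then 1 else 0) + z)"
    (is "?L \<longleftrightarrow> ?R")
proof -
  let ?d = "of_nat CARD('n) :: complex"
  have P: "trace (cmat_scale ?d (E j) ** cmat_scale ?d (E k)) = ?d\<^sup>2 * trace (E j ** E k)" for j k
    by (simp add: cmat_scale_mult_left cmat_scale_mult_right trace_cmat_scale power2_eq_square)
  have real: "trace (E j ** E k) \<in> \<real>" for j k
    using assms by (intro trace_mult_hermitian_real)
      (auto simp: informationally_complete_def measurement_def positive_semidefinite_def)
  show ?thesis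
  proof
    assume ?L
    then obtain \<alpha> \<zeta> :: real where
      "\<And>j k. ?d\<^sup>2 * trace (E j ** E k) = of_real (\<alpha> * (if j = k then 1 else 0) + \<zeta>)"
      by (auto simp: generalized_SIC_def Let_def P)
    then have "trace (E j ** E k) =
        of_real \<alpha> / ?d\<^sup>2 * (if j = k then 1 else 0) + of_real \<zeta> / ?d\<^sup>2" for j k
      by (simp add: field_simps)
    then show ?R by blast
  next
    assume ?R
    then obtain a z where g: "\<And>j k. trace (E j ** E k) = a * (if j = k then 1 else 0) + z"
      by blast
    have "trace (E j ** E k) = of_real (Re a * (if j = k then 1 else 0) + Re z)" for j k
    proof -
      have "trace (E j ** E k) = of_real (Re (trace (E j ** E k)))"
        using real by simp
      then show ?thesis
        by (simp add: g)
    qed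
    then have "trace (cmat_scale ?d (E j) ** cmat_scale ?d (E k)) =
        of_real ((real CARD('n))\<^sup>2 * Re a * (if j = k then 1 else 0) + (real CARD('n))\<^sup>2 * Re z)"
      for j k
      unfolding P by (simp add: algebra_simps)
    then show ?L
      using assms unfolding generalized_SIC_def Let_def by blast
  qed
qed

section \<open>The two implications\<close>

lemma antisymmetric_imp_gram:
  fixes E :: "'j::finite \<Rightarrow> complex ^ 'n ^ 'n"
  assumes E: "minimal_IC E" and anti: "completely_antisymmetric (structure_constants E)"
  shows "\<exists>a z. \<forall>j k. trace (E j ** E k) = a * (if j = k then 1 else 0) + z"
proof -
  let ?C = "structure_constants E"
  let ?g = "\<lambda>j k. trace (E j ** E k)"
  note span = minimal_IC_basis(3) [OF E]
  have one: "(\<Sum>l\<in>UNIV. E l) = mat 1"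
    using E by (simp add: minimal_IC_def informationally_complete_def measurement_def)
  define \<Phi> where "\<Phi> X = (\<Sum>l\<in>UNIV. cmat_scale (trace (X ** E l)) (E l))" for X
  have add: "\<Phi> (X + Y) = \<Phi> X + \<Phi> Y" for X Y
    by (simp add: \<Phi>_def matrix_add_rdistrib trace_add cmat.scale_left_distrib sum.distrib)
  have scale: "\<Phi> (cmat_scale c X) = cmat_scale c (\<Phi> X)" for c X
    by (simp add: \<Phi>_def cmat_scale_mult_left trace_cmat_scale cmat.scale_sum_right)
  have zero: "\<Phi> 0 = 0"
    using scale [of 0 0] by simp
  have basis: "\<Phi> (commutator (E j) (E k)) = commutator (E j) (\<Phi> (E k))" for j k
  proof -
    \<comment> \<open>Skewness moves the bracket onto \<open>E l\<close>; antisymmetry in the last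
      two indices then turns the expansion into the coefficients of
      \<open>commutator (E j) (\<Phi> (E k))\<close>.\<close>
    have "trace (commutator (E j) (E k) ** E l) = (\<Sum>m\<in>UNIV. ?g k m * ?C j m l)" for l
    proof -
      have "trace (commutator (E j) (E k) ** E l) = - trace (commutator (E j) (E l) ** E k)"
        by (rule trace_commutator_mult_swap)
      also have "\<dots> = (\<Sum>m\<in>UNIV. - ?C j l m * ?g m k)"
        by (simp add: commutator_eq_structure_constants [OF E] sum_matrix_mult trace_sum
            cmat_scale_mult_left trace_cmat_scale sum_negf)
      also have "\<dots> = (\<Sum>m\<in>UNIV. ?g k m * ?C j m l)"
      proof (rule sum.cong)
        fix m
        have "?C j l m = - ?C j m l"
          using anti unfolding completely_antisymmetric_def by blast
        then show "- ?C j l m * ?g m k = ?g k m * ?C j m l"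
          by (simp add: trace_mul_sym [of "E m" "E k"])
      qed simp
      finally show ?thesis .
    qed
    then have "\<Phi> (commutator (E j) (E k)) =
        (\<Sum>l\<in>UNIV. \<Sum>m\<in>UNIV. cmat_scale (?g k m) (cmat_scale (?C j m l) (E l)))"
      by (simp add: \<Phi>_def cmat.scale_sum_left)
    also have "\<dots> = (\<Sum>m\<in>UNIV. cmat_scale (?g k m) (\<Sum>l\<in>UNIV. cmat_scale (?C j m l) (E l)))"
      by (subst sum.swap) (simp add: cmat.scale_sum_right)
    also have "\<dots> = commutator (E j) (\<Phi> (E k))"
      by (simp add: \<Phi>_def commutator_sum_right commutator_scale_right
          commutator_eq_structure_constants [OF E])
    finally show ?thesis .
  qed
  \<comment> \<open>Equivariance on the basis extends by linearity, one argument at a time.\<close>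
  have right: "\<Phi> (commutator (E j) X) = commutator (E j) (\<Phi> X)" for j X
  proof (rule cmat.span_induct [of X "range E"])
    show "cmat.subspace {X. \<Phi> (commutator (E j) X) = commutator (E j) (\<Phi> X)}"
      by (rule cmat.subspaceI)
         (auto simp: commutator_add_right commutator_scale_right commutator_zero_right add scale zero)
  qed (use span basis in auto)
  have comm: "\<Phi> (commutator A X) = commutator A (\<Phi> X)" for A X
  proof (rule cmat.span_induct [of A "range E"])
    show "cmat.subspace {A. \<Phi> (commutator A X) = commutator A (\<Phi> X)}"
      by (rule cmat.subspaceI)
         (auto simp: commutator_add_left commutator_scale_left commutator_zero_left add scale zero)
  qed (use span right in auto)
  obtain a b where form: "\<And>X. \<Phi> X = cmat_scale a X + cmat_scale (b * trace X) (mat 1)"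
    using commutator_equivariant_form [of \<Phi>] add scale comm by metis
  \<comment> \<open>Both sides are coefficients of \<open>\<Phi> (E j)\<close>: by definition of
    \<open>\<Phi>\<close>, and by \<open>form\<close> with the identity written as the sum of all
    \<open>E l\<close>.\<close>
  have gram: "?g j k = a * (if j = k then 1 else 0) + b * trace (E j)" for j k
  proof (rule minimal_IC_coeff_unique [OF E, of "?g j"
        "\<lambda>k. a * (if j = k then 1 else 0) + b * trace (E j)"])
    have "(\<Sum>l\<in>UNIV. cmat_scale (a * (if j = l then 1 else 0)) (E l)) = cmat_scale a (E j)"
      by (subst sum.remove [of _ j]) auto
    then show "(\<Sum>l\<in>UNIV. cmat_scale (?g j l) (E l)) =
        (\<Sum>l\<in>UNIV. cmat_scale (a * (if j = l then 1 else 0) + b * trace (E j)) (E l))"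
      using form [of "E j"]
      by (simp add: \<Phi>_def cmat.scale_left_distrib sum.distrib flip: one cmat.scale_sum_right)
  qed
  have "b * trace (E j) = b * trace (E k)" for j k
    using gram [of j k] gram [of k j] trace_mul_sym [of "E j" "E k"] by (cases "j = k") auto
  then show ?thesis
    using gram by metis
qed

lemma gram_imp_antisymmetric:
  fixes E :: "'j::finite \<Rightarrow> complex ^ 'n ^ 'n"
  assumes E: "minimal_IC E"
    and gram: "\<And>j k. trace (E j ** E k) = a * (if j = k then 1 else 0) + z"
  shows "completely_antisymmetric (structure_constants E)"
proof -
  let ?C = "structure_constants E"
  note expand = commutator_eq_structure_constants [OF E]
  have one: "(\<Sum>l\<in>UNIV. E l) = mat 1"
    using E by (simp add: minimal_IC_def informationally_complete_def measurement_def)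
  \<comment> \<open>A row sum of the Gram matrix; since the \<open>E l\<close> sum to the identity,
    it is the common trace.\<close>
  define t where "t = a + of_nat CARD('j) * z"
  have tr: "trace (E j) = t" for j
  proof -
    have "trace (E j) = trace ((\<Sum>l\<in>UNIV. E l) ** E j)"
      by (simp add: one)
    also have "\<dots> = t"
      by (simp add: sum_matrix_mult trace_sum gram sum.distrib t_def flip: sum_distrib_left)
    finally show ?thesis .
  qed
  have "of_nat CARD('j) * t = of_nat CARD('n)"
    using arg_cong [OF one, of trace] by (simp add: trace_sum tr trace_I)
  then have "t \<noteq> 0"
    by auto
  \<comment> \<open>A commutator is traceless, and its expansion has trace \<open>t\<close> times
    this sum.\<close>
  have sum0: "(\<Sum>l\<in>UNIV. ?C j k l) = 0" for j k
    using trace_commutator [of "E j" "E k"] \<open>t \<noteq> 0\<close>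
    by (simp add: expand trace_sum trace_cmat_scale tr flip: sum_distrib_right)
  have aC: "a * ?C j k l = trace (commutator (E j) (E k) ** E l)" for j k l
  proof -
    have "trace (commutator (E j) (E k) ** E l) =
        (\<Sum>m\<in>UNIV. ?C j k m * (a * (if m = l then 1 else 0) + z))"
      by (simp add: expand sum_matrix_mult trace_sum cmat_scale_mult_left trace_cmat_scale gram)
    also have "\<dots> = (\<Sum>m\<in>UNIV. if m = l then a * ?C j k m else 0) + (\<Sum>m\<in>UNIV. ?C j k m) * z"
      unfolding sum_distrib_right sum.distrib [symmetric]
      by (intro sum.cong) (auto simp: algebra_simps)
    finally show ?thesis
      by (simp add: sum0)
  qed
  show ?thesis
  proof (cases "a = 0")
    \<comment> \<open>This occurs only in dimension one, where just \<open>a + z\<close> is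
      determined by the Gram matrix.\<close>
    case True
    have "E j = E k" for j k
    proof -
      have "E j - E k = 0"
        by (rule trace_form_nondegenerate [OF minimal_IC_basis(3) [OF E]])
           (auto simp: matrix_diff_rdistrib trace_sub gram True)
      then show ?thesis by simp
    qed
    then have "commutator (E j) (E k) = 0" for j k
      unfolding commutator_def by (metis diff_self)
    then have "?C j k l = 0" for j k l
      using minimal_IC_coeff_unique [OF E, of "?C j k" "\<lambda>_. 0" l] by (simp flip: expand)
    then show ?thesis
      by (simp add: completely_antisymmetric_def)
  next
    case False
    have "?C k j l = - ?C j k l" for j k l
    proof -
      have "a * ?C k j l = a * (- ?C j k l)"
        by (simp add: aC commutator_def matrix_diff_rdistrib trace_sub)
      then show ?thesis
        using False mult_left_cancel by blast
    qed
    moreover have "?C j l k = - ?C j k l" for j k l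
    proof -
      have "a * ?C j l k = a * (- ?C j k l)"
        using trace_commutator_mult_swap [of "E j" "E l" "E k"] by (simp add: aC)
      then show ?thesis
        using False mult_left_cancel by blast
    qed
    \<comment> \<open>The interchange of the outer indices is a product of three adjacent
      interchanges, hence also changes the sign.\<close>
    ultimately show ?thesis
      unfolding completely_antisymmetric_def by metis
  qed
qed

theorem theorem4:
  fixes E :: "'j::finite \<Rightarrow> complex ^ 'n ^ 'n"
  assumes "minimal_IC E"
  shows "completely_antisymmetric (structure_constants E) \<longleftrightarrow> generalized_SIC E"
proof -
  have "informationally_complete E"
    using assms by (simp add: minimal_IC_def)
  then show ?thesis
    using gram_iff_generalized_SIC antisymmetric_imp_gram [OF assms]
      gram_imp_antisymmetric [OF assms] by blast
qed

end
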